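(* Let $G$ be a connected, cubic (i.e. $3$-regular) bipartite circulant on $2n$ vertices with $G\simeq I+P^i+P^j$, where $i,j\in\{1,\dots,n-1\}$ are distinct, and suppose $\gcd(j,n)=d>1$. Then $$d<Z(G)\leq d+2\left(\frac{n}{d}\right)-2.$$
   Context: An $n\times n$ $(0,1)$-matrix $A$ is the biadjacency matrix of a bipartite graph on $2n$ vertices: there is one vertex for each row and one for each column, and a row vertex and a column vertex are adjacent if and only if the corresponding entry of $A$ is $1$. $G\simeq A$ means that $A$ is a biadjacency matrix of $G$ for some labeling of its vertices. A square matrix is circulant if each row is the row above it shifted one position to the right, the last entry wrapping to the first column. A bipartite circulant is a bipartite graph obtained from a square $(0,1)$ circulant matrix. $P$ is the $n\times n$ permutation matrix of the $n$-cycle $(1\ 2\ \cdots\ n)$, with ones in positions $(r,r+1)$ (indices mod $n$); $I=P^0$ is the identity. Zero forcing: color the vertices of a set $B\subseteq V(G)$ black and the others white. A black vertex $v$ may force a white neighbor $w$ to become black if $w$ is the unique white neighbor of $v$. $B$ is a zero forcing set if repeated applications of this rule eventually make all vertices black. $Z(G)$ is the minimum size of a zero forcing set of $G$. *)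

theory Defs
  imports "Jordan_Normal_Form.Matrix" "Graph_Theory.Graph_Theory"
begin

text \<open>A finite simple undirected graph is a \<^locale>\<open>pair_graph\<close>: a finite, loop-free
  digraph with a symmetric arc set, each edge being the two opposite arcs.\<close>

definition neighbours :: "'a pair_pre_digraph \<Rightarrow> 'a \<Rightarrow> 'a set" where
  "neighbours G v = {w. (v, w) \<in> parcs G}"

definition regular :: "nat \<Rightarrow> 'a pair_pre_digraph \<Rightarrow> bool" where
  "regular k G \<longleftrightarrow> (\<forall>v \<in> pverts G. card (neighbours G v) = k)"

definition cubic :: "'a pair_pre_digraph \<Rightarrow> bool" where
  "cubic G \<longleftrightarrow> regular 3 G"


definition zero_one_mat :: "int mat \<Rightarrow> bool" where
  "zero_one_mat A \<longleftrightarrow> elements_mat A \<subseteq> {0, 1}"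

definition circulant :: "int mat \<Rightarrow> bool" where
  "circulant A \<longleftrightarrow> square_mat A \<and>
     (\<forall>r c. Suc r < dim_row A \<longrightarrow> c < dim_row A \<longrightarrow>
        A $$ (Suc r, Suc c mod dim_row A) = A $$ (r, c))"

text \<open>The injections \<open>\<rho>\<close> and \<open>\<gamma>\<close> label the rows and the columns by vertices.\<close>

definition biadjacency_matrix :: "'a pair_pre_digraph \<Rightarrow> int mat \<Rightarrow> bool" (infix "\<simeq>\<^sub>b" 50) where
  "G \<simeq>\<^sub>b A \<longleftrightarrow> square_mat A \<and> zero_one_mat A \<and>
     (\<exists>\<rho> \<gamma>. inj_on \<rho> {..<dim_row A} \<and> inj_on \<gamma> {..<dim_row A} \<and>
        \<rho> ` {..<dim_row A} \<inter> \<gamma> ` {..<dim_row A} = {} \<and>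
        pverts G = \<rho> ` {..<dim_row A} \<union> \<gamma> ` {..<dim_row A} \<and>
        (\<forall>u v. (u, v) \<in> parcs G \<longleftrightarrow>
           (\<exists>r < dim_row A. \<exists>c < dim_row A. A $$ (r, c) = 1 \<and>
              (u = \<rho> r \<and> v = \<gamma> c \<or> u = \<gamma> c \<and> v = \<rho> r))))"

definition bipartite_circulant :: "'a pair_pre_digraph \<Rightarrow> bool" where
  "bipartite_circulant G \<longleftrightarrow> pair_graph G \<and> (\<exists>A. circulant A \<and> G \<simeq>\<^sub>b A)"

text \<open>Rows and columns are indexed by \<open>0, \<dots>, n - 1\<close>.\<close>

definition cycle_perm_mat :: "nat \<Rightarrow> int mat" where
  "cycle_perm_mat n = mat n n (\<lambda>(r, c). if c = Suc r mod n then 1 else 0)"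


text \<open>A single force with black set \<open>B\<close>, turning the black set into \<open>B'\<close>.\<close>

definition force_step :: "'a pair_pre_digraph \<Rightarrow> 'a set \<Rightarrow> 'a set \<Rightarrow> bool" where
  "force_step G B B' \<longleftrightarrow> (\<exists>v \<in> B. \<exists>w. neighbours G v - B = {w} \<and> B' = insert w B)"

definition zero_forcing_set :: "'a pair_pre_digraph \<Rightarrow> 'a set \<Rightarrow> bool" where
  "zero_forcing_set G B \<longleftrightarrow> B \<subseteq> pverts G \<and> (force_step G)\<^sup>*\<^sup>* B (pverts G)"

definition zero_forcing_number :: "'a pair_pre_digraph \<Rightarrow> nat" where
  "zero_forcing_number G = (LEAST k. \<exists>B. zero_forcing_set G B \<and> card B = k)"

end

theory Submission
  imports Defs "HOL-Number_Theory.Cong"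
begin

text \<open>Index rows and columns by residues mod \<open>n\<close>, so that row \<open>x\<close> is adjacent to the columns \<open>x\<close>,
  \<open>x + i\<close>, \<open>x + j\<close>. For the lower bound, put row \<open>x\<close> into the class \<open>x mod d\<close> and column \<open>x\<close> into the
  class \<open>(x - i) mod d\<close>. Each of the \<open>d\<close> classes is a fort: no vertex outside it has exactly one
  neighbour in it. So every zero forcing set meets every class. A vertex has one neighbour in its
  own class and two in another one, so a first force already needs two black vertices
  in the same class, and \<open>d\<close> black vertices are not enough.

  For the upper bound, connectedness gives \<open>gcd i d = 1\<close>, and the edges of \<open>I + P\<^sup>j\<close> split the graph into
  \<open>d\<close> cycles of length \<open>2n/d\<close>, the \<open>k\<close>-th on the indices congruent to \<open>ki\<close> mod \<open>d\<close>. Colour the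
  \<open>0\<close>-th cycle and one row in each of the cycles \<open>1, \<dots>, d - 2\<close>. A black \<open>k\<close>-th cycle forces the
  columns of the next one, whose black row then propagates around it; the rows of the last cycle
  are forced by the columns of the \<open>0\<close>-th.\<close>

subsection \<open>Zero forcing\<close>

text \<open>A reachable black set of maximal size admits no further force, so \<open>closed\<close>
  applies to it. Forcing can thus be shown by closure arguments on one set \<open>S\<close>, without
  ordering the forces.\<close>

lemma zero_forcing_setI:
  assumes fin: "finite (pverts G)" and nb: "\<And>v. neighbours G v \<subseteq> pverts G"
    and B: "B \<subseteq> pverts G"
    and closed: "\<And>S. B \<subseteq> S \<Longrightarrow> (\<And>v w. v \<in> S \<Longrightarrow> neighbours G v - S \<noteq> {w}) \<Longrightarrow> pverts G \<subseteq> S"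
  shows "zero_forcing_set G B"
proof -
  let ?Q = "\<lambda>S. (force_step G)\<^sup>*\<^sup>* B S"
  have sub: "B \<subseteq> S \<and> S \<subseteq> pverts G" if "?Q S" for S
    using that
  proof induction
    case base
    then show ?case using B by simp
  next
    case (step S T)
    then obtain v w where "neighbours G v - S = {w}" "T = insert w S"
      by (auto simp: force_step_def)
    with nb[of v] step.IH show ?case by blast
  qed
  have "\<exists>S. ?Q S \<and> (\<forall>T. ?Q T \<longrightarrow> card T \<le> card S)"
    by (rule ex_has_greatest_nat[where b = "Suc (card (pverts G))" and k = B])
      (use sub fin in \<open>auto intro: card_mono simp: less_Suc_eq_le\<close>)
  then obtain S where S: "?Q S" and max: "\<And>T. ?Q T \<Longrightarrow> card T \<le> card S"
    by blast
  have "pverts G \<subseteq> S"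
  proof (rule closed)
    show "B \<subseteq> S" using sub[OF S] by blast
    fix v w assume "v \<in> S"
    show "neighbours G v - S \<noteq> {w}"
    proof
      assume eq: "neighbours G v - S = {w}"
      with \<open>v \<in> S\<close> have "force_step G S (insert w S)"
        by (auto simp: force_step_def)
      with S have "?Q (insert w S)" by simp
      then have "card (insert w S) \<le> card S" by (rule max)
      moreover have "finite S" using sub[OF S] fin finite_subset by blast
      moreover have "w \<notin> S" using eq by blast
      ultimately show False by simp
    qed
  qed
  with sub[OF S] have "S = pverts G" by blast
  with S B show ?thesis by (simp add: zero_forcing_set_def)
qed

lemma zero_forcing_number_le:
  "zero_forcing_set G B \<Longrightarrow> zero_forcing_number G \<le> card B"
  unfolding zero_forcing_number_def by (rule Least_le) blast

lemma zero_forcing_number_attained: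
  assumes "zero_forcing_set G B"
  obtains B' where "zero_forcing_set G B'" "card B' = zero_forcing_number G"
proof -
  have "\<exists>B'. zero_forcing_set G B' \<and> card B' = zero_forcing_number G"
    unfolding zero_forcing_number_def
    by (rule LeastI[of "\<lambda>k. \<exists>B. zero_forcing_set G B \<and> card B = k" "card B"]) (use assms in blast)
  then show ?thesis using that by blast
qed

subsection \<open>Bipartite circulants with three nonzero diagonals\<close>

text \<open>\<open>R\<close> and \<open>C\<close> are \<open>n\<close>-periodic on all integers, so
  index shifts need no reduction. The three incongruences keep the neighbours of a vertex
  distinct.\<close>

locale three_diagonal_circulant =
  fixes G :: "'a pair_pre_digraph" and n i j :: int and R C :: "int \<Rightarrow> 'a"
  assumes n_pos: "n > 0"
    and R_eq_iff: "R x = R y \<longleftrightarrow> [x = y] (mod n)"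
    and C_eq_iff: "C x = C y \<longleftrightarrow> [x = y] (mod n)"
    and R_neq_C: "R x \<noteq> C y"
    and verts: "pverts G = range R \<union> range C"
    and neighbours_R: "neighbours G (R x) = {C x, C (x + i), C (x + j)}"
    and neighbours_C: "neighbours G (C x) = {R x, R (x - i), R (x - j)}"
    and neighbours_verts: "neighbours G v \<subseteq> pverts G"
    and i_nonzero: "\<not> [i = 0] (mod n)"
    and j_nonzero: "\<not> [j = 0] (mod n)"
    and i_neq_j: "\<not> [i = j] (mod n)"
begin

definition d :: int where "d = gcd j n"

lemma d_pos: "d > 0"
  using n_pos by (simp add: d_def)

lemma d_dvd: "d dvd j" "d dvd n"
  by (simp_all add: d_def)

lemma cong_d: "[x = y] (mod n) \<Longrightarrow> [x = y] (mod d)"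
  using cong_dvd_modulus d_dvd(2) by blast

lemma C_neq: "C x \<noteq> C (x + i)" "C x \<noteq> C (x + j)" "C (x + i) \<noteq> C (x + j)"
  using i_nonzero j_nonzero i_neq_j
  by (auto simp: C_eq_iff cong_iff_dvd_diff dvd_diff_commute)

lemma R_neq: "R x \<noteq> R (x - i)" "R x \<noteq> R (x - j)" "R (x - i) \<noteq> R (x - j)"
  using i_nonzero j_nonzero i_neq_j
  by (auto simp: R_eq_iff cong_iff_dvd_diff dvd_diff_commute)

lemma finite_verts: "finite (pverts G)"
proof -
  have "R x = R (x mod n)" "C x = C (x mod n)" "x mod n \<in> {0..<n}" for x
    using n_pos by (simp_all add: R_eq_iff C_eq_iff)
  then have "range R \<subseteq> R ` {0..<n}" "range C \<subseteq> C ` {0..<n}" by blast+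
  then show ?thesis
    unfolding verts by (metis finite_UnI finite_atLeastLessThan_int finite_imageI finite_subset)
qed

section \<open>Lower bound: the fort classes\<close>

definition fort_class :: "'a \<Rightarrow> int" where
  "fort_class v = (if v \<in> range R then (SOME x. v = R x) mod d else ((SOME x. v = C x) - i) mod d)"

lemma fort_class_R: "fort_class (R x) = x mod d"
proof -
  \<comment> \<open>The chosen index is determined modulo \<open>n\<close> only; its class is well
    defined because \<open>d\<close> divides \<open>n\<close>.\<close>
  have "R x = R (SOME y. R x = R y)" by (rule someI) simp
  then have "[x = (SOME y. R x = R y)] (mod d)" unfolding R_eq_iff by (rule cong_d)
  then show ?thesis by (simp add: fort_class_def cong_def)
qed

lemma fort_class_C: "fort_class (C x) = (x - i) mod d"
proof -
  have "C x = C (SOME y. C x = C y)" by (rule someI) simp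
  then have "[x = (SOME y. C x = C y)] (mod d)" unfolding C_eq_iff by (rule cong_d)
  then have "[x - i = (SOME y. C x = C y) - i] (mod d)" by (rule cong_diff) simp
  moreover have "C x \<notin> range R" using R_neq_C by (metis rangeE)
  ultimately show ?thesis by (simp add: fort_class_def cong_def)
qed

text \<open>The shift by \<open>i\<close> for columns puts both ends of an edge of offset
  \<open>i\<close> into one class; the indices of the other two neighbours differ by
  \<open>j\<close>, a multiple of \<open>d\<close>.\<close>

lemma neighbours_fort_class:
  assumes "v \<in> pverts G"
  obtains a b c where "neighbours G v = {a, b, c}" "a \<noteq> b" "a \<noteq> c" "b \<noteq> c" "a \<noteq> v"
    "fort_class a = fort_class v" "fort_class b = fort_class c"
proof -
  consider x where "v = R x" | x where "v = C x" using assms verts by blast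
  then show thesis
  proof cases
    case 1
    have "(x + j - i) mod d = (x - i) mod d"
      using d_dvd(1) by (simp add: mod_eq_dvd_iff)
    then show thesis
      by (intro that[of "C (x + i)" "C x" "C (x + j)"])
        (use C_neq[of x] C_neq[of x, symmetric] R_neq_C[of x, symmetric] in
          \<open>auto simp: 1 fort_class_R fort_class_C neighbours_R\<close>)
  next
    case 2
    have "x mod d = (x - j) mod d"
      using d_dvd(1) by (simp add: mod_eq_dvd_iff)
    then show thesis
      by (intro that[of "R (x - i)" "R x" "R (x - j)"])
        (use R_neq[of x] R_neq[of x, symmetric] R_neq_C[of _ x] in
          \<open>auto simp: 2 fort_class_R fort_class_C neighbours_C\<close>)
  qed
qed

lemma force_step_fort_class:
  assumes "force_step G S T" "S \<subseteq> pverts G"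
  shows "fort_class ` T = fort_class ` S" "\<not> inj_on fort_class S" "T \<subseteq> pverts G"
proof -
  obtain v w where v: "v \<in> S" and w: "neighbours G v - S = {w}" and T: "T = insert w S"
    using assms(1) by (auto simp: force_step_def)
  have "v \<in> pverts G" using v assms(2) by blast
  then obtain a b c where abc: "neighbours G v = {a, b, c}" "a \<noteq> b" "a \<noteq> c" "b \<noteq> c" "a \<noteq> v"
    "fort_class a = fort_class v" "fort_class b = fort_class c"
    by (rule neighbours_fort_class)
  have "w \<in> {a, b, c}" "{a, b, c} \<subseteq> insert w S"
    unfolding abc(1)[symmetric] using w by blast+
  then consider "w = a" "b \<in> S" "c \<in> S" | "w = b" "a \<in> S" "c \<in> S" | "w = c" "a \<in> S" "b \<in> S"
    using abc(2-4) by auto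
  \<comment> \<open>If \<open>w = a\<close>, its class is that of \<open>v\<close>, while
    \<open>b\<close> and \<open>c\<close> collide; if \<open>w\<close> is \<open>b\<close> or
    \<open>c\<close>, its class is that of the other one, while \<open>a\<close> and
    \<open>v\<close> collide.\<close>
  then have "fort_class w \<in> fort_class ` S \<and> \<not> inj_on fort_class S"
  proof cases
    case 1
    then show ?thesis using abc v by (metis image_eqI inj_onD)
  next
    case 2
    then show ?thesis using abc v by (metis image_eqI inj_onD)
  next
    case 3
    then show ?thesis using abc v by (metis image_eqI inj_onD)
  qed
  then show "fort_class ` T = fort_class ` S" "\<not> inj_on fort_class S"
    unfolding T by auto
  show "T \<subseteq> pverts G" using T w assms(2) neighbours_verts[of v] by blast
qed

lemma card_zero_forcing_set_gt:
  assumes "zero_forcing_set G B"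
  shows "d < int (card B)"
proof (rule ccontr)
  assume small: "\<not> d < int (card B)"
  have B: "B \<subseteq> pverts G" and steps: "(force_step G)\<^sup>*\<^sup>* B (pverts G)"
    using assms by (auto simp: zero_forcing_set_def)
  have fin: "finite B" using B finite_verts finite_subset by blast
  have "fort_class ` S = fort_class ` B \<and> S \<subseteq> pverts G" if "(force_step G)\<^sup>*\<^sup>* B S" for S
    using that by induction (use B force_step_fort_class in auto)
  with steps have img: "fort_class ` B = fort_class ` pverts G" by blast
  have "{0..<d} \<subseteq> fort_class ` B"
  proof
    fix k assume "k \<in> {0..<d}"
    then have "fort_class (R k) = k" by (simp add: fort_class_R)
    then show "k \<in> fort_class ` B" unfolding img verts by (metis UnI1 image_eqI rangeI)
  qed
  then have "card {0..<d} \<le> card (fort_class ` B)"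
    by (rule card_mono[rotated]) (use fin in simp)
  \<comment> \<open>All \<open>d\<close> classes occur among at most \<open>d\<close> vertices, so
    each occurs exactly once.\<close>
  with small have "card (fort_class ` B) = card B"
    using card_image_le[OF fin, of fort_class] d_pos by simp
  then have inj: "inj_on fort_class B" using fin eq_card_imp_inj_on by blast
  from steps show False
  proof (cases rule: converse_rtranclpE)
    case base
    \<comment> \<open>Without any force every vertex is already in \<open>B\<close>, and two of
      these share a class.\<close>
    have "fort_class (R 0) = fort_class (C i)" by (simp add: fort_class_R fort_class_C)
    then show False using inj R_neq_C base verts by (metis UnCI inj_onD rangeI)
  next
    case (step S)
    then show False using force_step_fort_class(2) B inj by blast
  qed
qed

subsection \<open>The upper bound\<close>

text \<open>The multiples of \<open>d\<close> modulo \<open>n\<close> index the \<open>0\<close>-th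
  cycle. The interval \<open>{1..<d - 1}\<close> ends at \<open>d - 2\<close> and is empty for
  \<open>d = 2\<close>.\<close>

definition forcing_start :: "'a set" where
  "forcing_start = (\<lambda>t. R (d * t)) ` {0..<n div d} \<union> (\<lambda>t. C (d * t)) ` {0..<n div d}
     \<union> (\<lambda>k. R (k * i)) ` {1..<d - 1}"

lemma card_forcing_start:
  assumes "d > 1"
  shows "int (card forcing_start) \<le> d + 2 * (n div d) - 2"
proof -
  have "0 \<le> n div d" using n_pos d_pos by (simp add: pos_imp_zdiv_nonneg_iff)
  have "card forcing_start \<le> card ((\<lambda>t. R (d * t)) ` {0..<n div d})
      + card ((\<lambda>t. C (d * t)) ` {0..<n div d}) + card ((\<lambda>k. R (k * i)) ` {1..<d - 1})"
    unfolding forcing_start_def by (meson add_le_mono card_Un_le le_trans order_refl)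
  also have "\<dots> \<le> card {0..<n div d} + card {0..<n div d} + card {1..<d - 1}"
    by (intro add_mono card_image_le) auto
  finally show ?thesis using assms \<open>0 \<le> n div d\<close> by simp
qed

lemma zero_forcing_set_forcing_start:
  assumes "d > 1" and "coprime i d"
  shows "zero_forcing_set G forcing_start"
proof (rule zero_forcing_setI[OF finite_verts neighbours_verts])
  show "forcing_start \<subseteq> pverts G" by (auto simp: forcing_start_def verts)
next
  fix S assume start: "forcing_start \<subseteq> S"
    and closed: "\<And>v w. v \<in> S \<Longrightarrow> neighbours G v - S \<noteq> {w}"
  have force: "w \<in> S" if "v \<in> S" "neighbours G v = {w, a, b}" "a \<in> S" "b \<in> S" for v w a b
    using closed[OF that(1), of w] that(2-) by blast
  \<comment> \<open>\<open>layer k\<close> holds the indices of the \<open>k\<close>-th cycle: edges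
    of offset \<open>0\<close> and \<open>j\<close> stay inside it, those of offset \<open>i\<close>
    lead from its rows to the columns of \<open>layer (k + 1)\<close>.\<close>
  define layer where "layer k = {x. [x = k * i] (mod d)}" for k
  have layer_j: "x + j \<in> layer k \<longleftrightarrow> x \<in> layer k" "x - j \<in> layer k \<longleftrightarrow> x \<in> layer k" for x k
    using d_dvd(1) by (auto simp: layer_def cong_iff_dvd_diff algebra_simps
        dvd_add_right_iff dvd_diff_right_iff) (metis dvd_add_right_iff add_diff_eq diff_add_eq)+
  have layer_i: "x - i \<in> layer k" if "x \<in> layer (k + 1)" for x k
    using that by (simp add: layer_def cong_iff_dvd_diff algebra_simps)
  have start0: "R x \<in> S \<and> C x \<in> S" if "x \<in> layer 0" for x
  proof -
    have "d dvd x mod n" using that d_dvd(2) by (simp add: layer_def cong_0_iff dvd_mod)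
    then obtain t where t: "x mod n = d * t" by blast
    have "0 \<le> d * t" "d * t < n" using n_pos by (simp_all flip: t)
    then have "0 \<le> t" using d_pos by (simp add: zero_le_mult_iff)
    moreover have "t < n div d"
      using \<open>d * t < n\<close> d_dvd(2) d_pos by (metis dvd_mult_div_cancel mult_less_cancel_left_pos)
    moreover have "R x = R (d * t)" "C x = C (d * t)"
      unfolding R_eq_iff C_eq_iff by (simp_all flip: t)
    ultimately show ?thesis using start by (auto simp: forcing_start_def)
  qed
  \<comment> \<open>The column at \<open>x + j\<close> sees a black row at \<open>x\<close> and
    another at \<open>x + j - i\<close> in the previous layer, so it forces the row at
    \<open>x + j\<close>; blackness travels in steps of \<open>j\<close>.\<close>
  have around: "R y \<in> S" if cols: "\<And>x. x \<in> layer k \<Longrightarrow> C x \<in> S \<and> R (x - i) \<in> S"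
    and r: "r \<in> layer k" "R r \<in> S" and y: "y \<in> layer k" for k r y
  proof -
    have walk: "R (r + int t * j) \<in> S \<and> r + int t * j \<in> layer k" for t
    proof (induction t)
      case 0
      then show ?case using r by simp
    next
      case (Suc t)
      let ?x = "r + int t * j"
      have "?x + j \<in> layer k" using Suc layer_j by blast
      moreover have "R (?x + j) \<in> S"
        by (rule force[of "C (?x + j)" _ "R (?x + j - i)" "R ?x"])
          (use cols[OF calculation] neighbours_C[of "?x + j"] Suc in auto)
      ultimately show ?case by (simp add: algebra_simps)
    qed
    \<comment> \<open>By Bezout \<open>d\<close> is a multiple of \<open>j\<close> modulo
      \<open>n\<close>, so steps of \<open>j\<close> reach every index congruent to \<open>r\<close>
      modulo \<open>d\<close>.\<close>
    obtain u where u: "[j * u = d] (mod n)" using cong_solve_int d_def by metis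
    have "[y = r] (mod d)" using r(1) y by (auto simp: layer_def cong_def)
    then obtain q where q: "y - r = d * q" by (auto simp: cong_iff_dvd_diff)
    \<comment> \<open>Reduction modulo \<open>n\<close> makes the number of steps
      nonnegative.\<close>
    let ?t = "nat ((u * q) mod n)"
    have "[r + int ?t * j = r + (u * q) * j] (mod n)"
      using n_pos by (intro cong_add cong_mult) (simp_all add: cong_def)
    also have "r + (u * q) * j = r + (j * u) * q" by simp
    also have "[\<dots> = r + d * q] (mod n)" using u by (intro cong_add cong_mult) auto
    also have "r + d * q = y" using q by simp
    finally have "R (r + int ?t * j) = R y" by (simp add: R_eq_iff)
    then show ?thesis using walk[of ?t] by simp
  qed
  have layers: "int k < d \<Longrightarrow> \<forall>x \<in> layer (int k). R x \<in> S \<and> C x \<in> S" for k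
  proof (induction k)
    case 0
    then show ?case using start0 by simp
  next
    case (Suc k)
    let ?k = "int (Suc k)"
    have prev: "R (x - i) \<in> S" "C (x - i) \<in> S" "C (x - i + j) \<in> S" if "x \<in> layer ?k" for x
    proof -
      have "x - i \<in> layer (int k)" using that layer_i[of x "int k"] by (simp add: add.commute)
      then show "R (x - i) \<in> S" "C (x - i) \<in> S" "C (x - i + j) \<in> S"
        using Suc layer_j by auto
    qed
    \<comment> \<open>The other two neighbours of the row at \<open>x - i\<close> lie in the
      previous layer.\<close>
    have cols: "C x \<in> S" if "x \<in> layer ?k" for x
      by (rule force[of "R (x - i)" _ "C (x - i)" "C (x - i + j)"])
        (use prev[OF that] neighbours_R[of "x - i"] in auto)
    have rows: "R x \<in> S" if x: "x \<in> layer ?k" for x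
    proof (cases "?k = d - 1")
      case True
      \<comment> \<open>The layer after the last one is \<open>layer 0\<close>, since
        \<open>d * i\<close> vanishes modulo \<open>d\<close>; its columns force the remaining
        rows.\<close>
      have "[x + i = ?k * i + i] (mod d)" using x by (simp add: layer_def cong_add)
      moreover have "?k + 1 = d" using True by simp
      then have "?k * i + i = d * i" by (metis distrib_right mult_1)
      ultimately have "x + i \<in> layer 0" by (simp add: layer_def cong_def)
      then have next_S: "R (x + i) \<in> S" "C (x + i) \<in> S" "R (x + i - j) \<in> S"
        using start0 layer_j by auto
      show ?thesis
        by (rule force[of "C (x + i)" _ "R (x + i)" "R (x + i - j)"])
          (use next_S neighbours_C[of "x + i"] in auto)
    next
      case False
      then have "R (?k * i) \<in> S"
        using start Suc.prems by (force simp: forcing_start_def)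
      moreover have "?k * i \<in> layer ?k" by (simp add: layer_def)
      ultimately show ?thesis using around cols prev(1) x by blast
    qed
    from cols rows show ?case by blast
  qed
  have "R x \<in> S \<and> C x \<in> S" for x
  proof -
    \<comment> \<open>\<open>i\<close> is invertible modulo \<open>d\<close>, so the layers
      \<open>0\<close> to \<open>d - 1\<close> cover all indices.\<close>
    obtain u where u: "[i * u = 1] (mod d)" using cong_solve_coprime_int[OF assms(2)] by blast
    let ?k = "nat ((u * x) mod d)"
    have "[int ?k * i = (u * x) * i] (mod d)"
      using d_pos by (intro cong_mult) (simp_all add: cong_def)
    also have "(u * x) * i = (i * u) * x" by simp
    also have "[\<dots> = 1 * x] (mod d)" using u by (intro cong_mult) auto
    finally have "x \<in> layer (int ?k)" by (simp add: layer_def cong_sym_eq)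
    moreover have "int ?k < d" using d_pos by simp
    ultimately show ?thesis using layers by blast
  qed
  then show "pverts G \<subseteq> S" unfolding verts by blast
qed

text \<open>All edges preserve the index modulo \<open>gcd i d\<close>.\<close>

lemma coprime_if_connected:
  assumes "Digraph_Component.connected (with_proj G)" and sym: "sym (parcs G)"
  shows "coprime i d"
proof -
  define g where "g = gcd i d"
  have g: "g dvd i" "g dvd d" "g dvd j" "g dvd n"
    using d_dvd by (auto simp: g_def intro: dvd_trans)
  \<comment> \<open>A relation rather than a function, because the index of a vertex is fixed only
    modulo \<open>n\<close>.\<close>
  define h where "h v x \<longleftrightarrow> (\<exists>y. (v = R y \<or> v = C y) \<and> [x = y] (mod g))" for v x
  have h_step: "h w x" if "h v x" "w \<in> neighbours G v" for v w x
  proof -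
    from that(1) obtain y where y: "v = R y \<or> v = C y" "[x = y] (mod g)"
      by (auto simp: h_def)
    have "\<exists>z\<in>{y, y + i, y + j, y - i, y - j}. w = R z \<or> w = C z"
      using y(1) that(2) neighbours_R[of y] neighbours_C[of y] by auto
    then obtain z where "z \<in> {y, y + i, y + j, y - i, y - j}" "w = R z \<or> w = C z" by blast
    moreover from this have "g dvd z - y" using g by auto
    then have "[y = z] (mod g)" by (simp add: cong_iff_dvd_diff dvd_diff_commute)
    ultimately show ?thesis using y(2) cong_trans unfolding h_def by blast
  qed
  \<comment> \<open>A path from index \<open>0\<close> to index \<open>1\<close> makes
    \<open>g\<close> divide \<open>1\<close>.\<close>
  have "(R 0, R 1) \<in> rtrancl_on (pverts G) (parcs (mk_symmetric (with_proj G)))"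
    using assms(1) verts
    by (auto simp: Digraph_Component.connected_def strongly_connected_def reachable_def)
  moreover have "parcs (mk_symmetric (with_proj G)) = parcs G"
    using symD[OF sym] by (auto simp: parcs_mk_symmetric)
  ultimately have "(R 0, R 1) \<in> rtrancl_on (pverts G) (parcs G)" by simp
  moreover have "h v 0" if "(R 0, v) \<in> rtrancl_on (pverts G) (parcs G)" for v
    using that
  proof (induction rule: rtrancl_on_induct)
    case base
    have "[0 = 0] (mod g)" by simp
    then show ?case unfolding h_def by blast
  next
    case (step v w)
    then show ?case using h_step by (simp add: neighbours_def)
  qed
  ultimately have "h (R 1) 0" by simp
  then obtain y where "R 1 = R y" "[0 = y] (mod g)"
    using R_neq_C by (auto simp: h_def)
  then have "[0 = 1] (mod g)"
    unfolding R_eq_iff using g(4) cong_dvd_modulus cong_trans cong_sym by metis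
  then have "g dvd 1" by (simp add: cong_iff_dvd_diff)
  then show ?thesis by (simp add: g_def coprime_iff_gcd_eq_1)
qed

end

subsection \<open>From the matrix to the graph\<close>

lemma cycle_perm_mat_pow:
  "cycle_perm_mat n ^\<^sub>m k = mat n n (\<lambda>(r, c). if c = (r + k) mod n then 1 else 0)"
proof (induction k)
  case 0
  show ?case by (rule eq_matI) (auto simp: cycle_perm_mat_def)
next
  case (Suc k)
  \<comment> \<open>Only the term \<open>l = (r + k) mod n\<close> survives.\<close>
  have "(\<Sum>l = 0..<n. (if l = (r + k) mod n then 1 else 0) * (if c = Suc l mod n then 1 else 0))
      = (if c = Suc (r + k) mod n then 1 else 0 :: int)" if "r < n" for r c
    using that by (simp add: if_distrib[of "\<lambda>x. x * _"] sum.delta mod_Suc_eq cong: if_cong)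
  then show ?case
    unfolding pow_mat.simps Suc
    by (intro eq_matI) (auto simp: cycle_perm_mat_def scalar_prod_def)
qed

text \<open>The three diagonals meet a row in distinct columns, so no entry exceeds
  \<open>1\<close>.\<close>

lemma three_diagonal_mat_entry:
  fixes i j n :: nat
  assumes "0 < i" "i < n" "0 < j" "j < n" "i \<noteq> j" "r < n" "c < n"
  shows "(1\<^sub>m n + cycle_perm_mat n ^\<^sub>m i + cycle_perm_mat n ^\<^sub>m j) $$ (r, c) = 1 \<longleftrightarrow>
    c = r \<or> c = (r + i) mod n \<or> c = (r + j) mod n"
proof -
  have "(r + i) mod n \<noteq> r" "(r + j) mod n \<noteq> r" "(r + i) mod n \<noteq> (r + j) mod n"
    using assms by (auto simp: mod_if)
  then show ?thesis using assms by (auto simp: cycle_perm_mat_pow)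
qed

text \<open>The labellings of rows and columns are extended periodically to all integers by
  reduction modulo \<open>n\<close>.\<close>

lemma three_diagonal_circulant_if_biadjacency_matrix:
  fixes n i j :: nat
  assumes ij: "i \<in> {1..n - 1}" "j \<in> {1..n - 1}" "i \<noteq> j"
    and G: "G \<simeq>\<^sub>b 1\<^sub>m n + cycle_perm_mat n ^\<^sub>m i + cycle_perm_mat n ^\<^sub>m j" (is "G \<simeq>\<^sub>b ?A")
  obtains R C where "three_diagonal_circulant G (int n) (int i) (int j) R C"
    "sym (parcs G)"
proof -
  have lt: "0 < i" "i < n" "0 < j" "j < n" using ij by auto
  have dim: "dim_row ?A = n" by (simp add: cycle_perm_mat_pow)
  obtain \<rho> \<gamma> where inj: "inj_on \<rho> {..<n}" "inj_on \<gamma> {..<n}"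
    and disj: "\<rho> ` {..<n} \<inter> \<gamma> ` {..<n} = {}" and V: "pverts G = \<rho> ` {..<n} \<union> \<gamma> ` {..<n}"
    and E: "\<forall>u v. (u, v) \<in> parcs G \<longleftrightarrow> (\<exists>r < n. \<exists>c < n. ?A $$ (r, c) = 1 \<and>
              (u = \<rho> r \<and> v = \<gamma> c \<or> u = \<gamma> c \<and> v = \<rho> r))"
    using G unfolding biadjacency_matrix_def dim by (elim conjE exE) (rule that)
  define idx where "idx x = nat (x mod int n)" for x
  have idx_lt: "idx x < n" for x using lt by (simp add: idx_def nat_less_iff)
  have idx_eq: "idx x = idx y \<longleftrightarrow> [x = y] (mod int n)" for x y
    using lt by (simp add: idx_def cong_def eq_nat_nat_iff)
  have idx_int: "idx (int r) = r" if "r < n" for r using that by (simp add: idx_def)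
  have idx_add: "(idx x + k) mod n = idx (x + int k)" for x k
  proof -
    have "int ((idx x + k) mod n) = int (idx (x + int k))"
      using lt by (simp add: idx_def zmod_int mod_add_left_eq)
    then show ?thesis by (simp only: of_nat_eq_iff)
  qed
  have range_idx: "range idx = {..<n}"
    using idx_lt idx_int by (fastforce simp: image_iff intro: sym)
  define R where "R x = \<rho> (idx x)" for x
  define C where "C x = \<gamma> (idx x)" for x
  have range: "range R = \<rho> ` {..<n}" "range C = \<gamma> ` {..<n}"
    unfolding R_def C_def range_idx[symmetric] by (auto simp: image_image)
  have verts: "pverts G = range R \<union> range C"
    by (simp only: V range)
  have R_eq: "R x = R y \<longleftrightarrow> [x = y] (mod int n)" for x y
    using inj(1) idx_lt by (auto simp: R_def inj_on_eq_iff simp flip: idx_eq)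
  have C_eq: "C x = C y \<longleftrightarrow> [x = y] (mod int n)" for x y
    using inj(2) idx_lt by (auto simp: C_def inj_on_eq_iff simp flip: idx_eq)
  have RC: "R x \<noteq> C y" for x y
    using disj range by blast
  \<comment> \<open>Collecting the offsets treats the three kinds of edges uniformly.\<close>
  define K where "K = {0, int i, int j}"
  have E': "(u, v) \<in> parcs G \<longleftrightarrow>
      (\<exists>x. \<exists>k \<in> K. u = R x \<and> v = C (x + k) \<or> u = C (x + k) \<and> v = R x)" for u v
  proof -
    have "(u, v) \<in> parcs G \<longleftrightarrow> (\<exists>r < n. \<exists>c < n. (c = r \<or> c = (r + i) mod n \<or> c = (r + j) mod n) \<and>
              (u = \<rho> r \<and> v = \<gamma> c \<or> u = \<gamma> c \<and> v = \<rho> r))"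
      unfolding E[rule_format]
      by (simp only: three_diagonal_mat_entry[OF lt ij(3)] cong: conj_cong)
    also have "\<dots> \<longleftrightarrow> (\<exists>r \<in> range idx. \<exists>c. (c = r \<or> c = (r + i) mod n \<or> c = (r + j) mod n) \<and>
              (u = \<rho> r \<and> v = \<gamma> c \<or> u = \<gamma> c \<and> v = \<rho> r))"
    proof -
      have "c < n" if "r < n" "c = r \<or> c = (r + i) mod n \<or> c = (r + j) mod n" for r c
        using that lt by auto
      then show ?thesis unfolding range_idx Bex_def lessThan_iff by blast
    qed
    also have "\<dots> \<longleftrightarrow> (\<exists>x. \<exists>k \<in> K. u = R x \<and> v = C (x + k) \<or> u = C (x + k) \<and> v = R x)"
      unfolding R_def C_def K_def by (simp add: idx_add) blast
    finally show ?thesis .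
  qed
  have nonzero: "\<not> [int i = 0] (mod int n)" "\<not> [int j = 0] (mod int n)"
    "\<not> [int i = int j] (mod int n)"
    using lt ij(3) by (auto simp: cong_def)
  have cong_R: "R (y - k) = R x" if "C (x + k) = C y" for x y k
    using that by (simp add: R_eq C_eq cong_iff_dvd_diff algebra_simps dvd_diff_commute)
  have cong_C: "C (x + k) = C (y + k)" if "R x = R y" for x y k
    using that by (simp add: R_eq C_eq cong_iff_dvd_diff)
  have nR: "neighbours G (R x) = {C x, C (x + int i), C (x + int j)}" for x
  proof -
    have "neighbours G (R x) = (\<lambda>k. C (x + k)) ` K"
    proof (intro equalityI subsetI)
      fix v assume "v \<in> neighbours G (R x)"
      then obtain y k where "k \<in> K" "R x = R y" "v = C (y + k)"
        using RC unfolding neighbours_def E' by blast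
      with cong_C[of x y k] show "v \<in> (\<lambda>k. C (x + k)) ` K" by (metis image_eqI)
    qed (auto simp: neighbours_def E')
    then show ?thesis by (simp add: K_def)
  qed
  have nC: "neighbours G (C x) = {R x, R (x - int i), R (x - int j)}" for x
  proof -
    have "neighbours G (C x) = (\<lambda>k. R (x - k)) ` K"
    proof (intro equalityI subsetI)
      fix v assume "v \<in> neighbours G (C x)"
      then obtain y k where "k \<in> K" "C x = C (y + k)" "v = R y"
        using RC unfolding neighbours_def E' mem_Collect_eq by metis
      with cong_R[of y k x] show "v \<in> (\<lambda>k. R (x - k)) ` K" by (metis image_eqI)
    next
      fix v assume "v \<in> (\<lambda>k. R (x - k)) ` K"
      then obtain k where "k \<in> K" "v = R (x - k)" by blast
      moreover have "C x = C ((x - k) + k)" by simp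
      ultimately show "v \<in> neighbours G (C x)"
        unfolding neighbours_def E' mem_Collect_eq by metis
    qed
    then show ?thesis by (simp add: K_def)
  qed
  show thesis
  proof
    show "three_diagonal_circulant G (int n) (int i) (int j) R C"
    proof
      show "neighbours G v \<subseteq> pverts G" for v
        unfolding verts by (auto simp: neighbours_def E')
    qed (use lt R_eq C_eq RC nR nC nonzero verts in auto)
    show "sym (parcs G)"
      by (rule symI) (auto simp: E')
  qed
qed

section \<open>The two bounds for the given graph\<close>

theorem theorem4p3:
  fixes G :: "'a pair_pre_digraph" and n i j d :: nat
  assumes "bipartite_circulant G"
    and "card (pverts G) = 2 * n"
    and "Digraph_Component.connected (with_proj G)"
    and "cubic G"
    and "i \<in> {1..n - 1}" and "j \<in> {1..n - 1}" and "i \<noteq> j"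
    and "G \<simeq>\<^sub>b 1\<^sub>m n + cycle_perm_mat n ^\<^sub>m i + cycle_perm_mat n ^\<^sub>m j"
    and "gcd j n = d" and "d > 1"
  shows "real d < real (zero_forcing_number G) \<and>
    real (zero_forcing_number G) \<le> real d + 2 * (real n / real d) - 2"
proof -
  obtain R C where circ: "three_diagonal_circulant G (int n) (int i) (int j) R C"
    and sym: "sym (parcs G)"
    using three_diagonal_circulant_if_biadjacency_matrix[OF assms(5-8)] .
  interpret three_diagonal_circulant G "int n" "int i" "int j" R C by (fact circ)
  \<comment> \<open>The fixed \<open>d\<close> hides the locale constant of that name, hence the
    qualified form; both are the gcd.\<close>
  have d: "three_diagonal_circulant.d (int n) (int j) = int d"
    using assms(9) by (auto simp: d_def)
  have zf: "zero_forcing_set G forcing_start"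
    using zero_forcing_set_forcing_start coprime_if_connected[OF assms(3) sym] assms(10) d by simp
  obtain B where "zero_forcing_set G B" "card B = zero_forcing_number G"
    using zero_forcing_number_attained[OF zf] .
  then have lower: "d < zero_forcing_number G"
    using card_zero_forcing_set_gt d by force
  have "int (zero_forcing_number G) \<le> int d + 2 * (int n div int d) - 2"
    using zero_forcing_number_le[OF zf] card_forcing_start assms(10) d by simp
  then have "int (zero_forcing_number G) \<le> int d + 2 * int (n div d) - 2"
    by (simp add: zdiv_int)
  then have "real (zero_forcing_number G) \<le> real d + 2 * real (n div d) - 2"
    by linarith
  \<comment> \<open>The quotient is exact because \<open>d\<close> divides \<open>n\<close>.\<close>
  moreover have "real (n div d) = real n / real d"
    using assms(9) by (intro real_of_nat_div) auto
  ultimately show ?thesis using lower by simp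
qed

end
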